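(* Let $T,S\in\mathcal{B}_A(\mathcal{H})$. Then $$\|T+S\|_A^2\leq \frac{1}{2}\left(\left\|T^{\sharp_A} T+S^{\sharp_A} S\right\|_A+\left\|T^{\sharp_A} T-S^{\sharp_A} S\right\|_A\right)+\|T\|_A\|S\|_A+2w_A(S^{\sharp_A} T).$$
   Context: $(\mathcal{H},\langle\cdot,\cdot\rangle)$ is a nontrivial complex Hilbert space, $\mathcal{B}(\mathcal{H})$ is the algebra of bounded linear operators on $\mathcal{H}$, and $A\in\mathcal{B}(\mathcal{H})$ is a positive operator, i.e. $\langle Ax,x\rangle\ge 0$ for all $x\in\mathcal{H}$. The semi-inner product induced by $A$ is $\langle x,y\rangle_A=\langle Ax,y\rangle$, with seminorm $\|x\|_A=\sqrt{\langle x,x\rangle_A}$ on $\mathcal{H}$. $\mathcal{B}_A(\mathcal{H})=\{T\in\mathcal{B}(\mathcal{H}): \operatorname{ran}(T^*A)\subseteq\operatorname{ran}(A)\}$ is the set of operators admitting an $A$-adjoint. For $T\in\mathcal{B}_A(\mathcal{H})$, $T^{\sharp_A}=A^{\dagger}T^*A$ (with $A^\dagger$ the Moore-Penrose inverse of $A$) is the unique bounded solution $X$ of $AX=T^*A$ whose range is contained in $\overline{\operatorname{ran}(A)}$; it satisfies $\langle Tx,y\rangle_A=\langle x,T^{\sharp_A}y\rangle_A$ for all $x,y\in\mathcal{H}$. For $T\in\mathcal{B}_A(\mathcal{H})$, the $A$-operator seminorm is $\|T\|_A=\sup\{\|Tx\|_A: x\in\mathcal{H},\ \|x\|_A=1\}$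 and the $A$-numerical radius is $w_A(T)=\sup\{|\langle Tx,x\rangle_A|: x\in\mathcal{H},\ \|x\|_A=1\}$. *)

theory Defs
  imports "HOL-Analysis.Analysis"
begin

text \<open>
  A complex Hilbert space is a real Hilbert space with a compatible complex scalar multiplication
  and a complex inner product, linear in its first argument, whose real part is the given real
  inner product; in particular the norm of \<open>x\<close> is \<open>sqrt (Re (cinner x x))\<close>.  Positive
  definiteness and completeness are inherited from \<^class>\<open>real_inner\<close> and \<^class>\<open>banach\<close>.
\<close>

class chilbert_space = real_inner + banach +
  fixes scaleC :: "complex \<Rightarrow> 'a \<Rightarrow> 'a" (infixr "*\<^sub>C" 75)
    and cinner :: "'a \<Rightarrow> 'a \<Rightarrow> complex"
  assumes scaleC_of_real: "complex_of_real r *\<^sub>C x = r *\<^sub>R x"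
    and scaleC_add_right: "c *\<^sub>C (x + y) = c *\<^sub>C x + c *\<^sub>C y"
    and scaleC_add_left: "(c + d) *\<^sub>C x = c *\<^sub>C x + d *\<^sub>C x"
    and scaleC_scaleC: "c *\<^sub>C d *\<^sub>C x = (c * d) *\<^sub>C x"
    and cinner_add_left: "cinner (x + y) z = cinner x z + cinner y z"
    and cinner_scaleC_left: "cinner (c *\<^sub>C x) y = c * cinner x y"
    and cinner_commute: "cinner x y = cnj (cinner y x)"
    and Re_cinner: "Re (cinner x y) = x \<bullet> y"

definition bounded_clinear :: "('a::chilbert_space \<Rightarrow> 'a) \<Rightarrow> bool" where
  "bounded_clinear T \<longleftrightarrow> bounded_linear T \<and> (\<forall>c x. T (c *\<^sub>C x) = c *\<^sub>C T x)"

definition positive_op :: "('a::chilbert_space \<Rightarrow> 'a) \<Rightarrow> bool" where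
  "positive_op A \<longleftrightarrow> bounded_clinear A \<and> (\<forall>x. cinner (A x) x \<in> \<real>\<^sub>\<ge>\<^sub>0)"

definition cadjoint :: "('a::chilbert_space \<Rightarrow> 'a) \<Rightarrow> 'a \<Rightarrow> 'a" where
  "cadjoint T = (THE S. bounded_clinear S \<and> (\<forall>x y. cinner (T x) y = cinner x (S y)))"

definition orth_compl :: "'a::chilbert_space set \<Rightarrow> 'a set" where
  "orth_compl M = {x. \<forall>y\<in>M. cinner x y = 0}"

text \<open>
  The Moore-Penrose inverse of \<open>A\<close> is defined on \<open>ran A + (ran A)\<^sup>\<bottom>\<close>: it inverts the restriction
  of \<open>A\<close> to \<open>(ker A)\<^sup>\<bottom>\<close> and vanishes on \<open>(ran A)\<^sup>\<bottom>\<close>.  So \<open>y = A x + z\<close> with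
  \<open>x \<in> (ker A)\<^sup>\<bottom>\<close> and \<open>z \<in> (ran A)\<^sup>\<bottom>\<close> is sent to \<open>x\<close>.  The range of \<open>A\<close> need not be closed;
  the value at a point outside this domain is unspecified.
\<close>

definition mp_inverse :: "('a::chilbert_space \<Rightarrow> 'a) \<Rightarrow> 'a \<Rightarrow> 'a" where
  "mp_inverse A y =
    (THE x. x \<in> orth_compl {u. A u = 0} \<and> (\<exists>z \<in> orth_compl (range A). y = A x + z))"

definition adjointable :: "('a::chilbert_space \<Rightarrow> 'a) \<Rightarrow> ('a \<Rightarrow> 'a) set" where
  "adjointable A = {T. bounded_clinear T \<and> range (cadjoint T \<circ> A) \<subseteq> range A}"

definition sharp :: "('a::chilbert_space \<Rightarrow> 'a) \<Rightarrow> ('a \<Rightarrow> 'a) \<Rightarrow> 'a \<Rightarrow> 'a" where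
  "sharp A T = mp_inverse A \<circ> cadjoint T \<circ> A"

definition semi_inner :: "('a::chilbert_space \<Rightarrow> 'a) \<Rightarrow> 'a \<Rightarrow> 'a \<Rightarrow> complex" where
  "semi_inner A x y = cinner (A x) y"

text \<open>For positive \<open>A\<close> the number \<open>semi_inner A x x\<close> is real, so \<^const>\<open>Re\<close> is only a coercion.\<close>

definition seminorm :: "('a::chilbert_space \<Rightarrow> 'a) \<Rightarrow> 'a \<Rightarrow> real" where
  "seminorm A x = sqrt (Re (semi_inner A x x))"

text \<open>
  Both suprema below are taken in \<open>[0,\<infinity>)\<close>: adjoining \<open>0\<close> changes nothing unless no \<open>x\<close> has
  \<open>seminorm A x = 1\<close> (that is, \<open>A = 0\<close>), where it makes the supremum of the empty set \<open>0\<close>.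
  For \<open>T \<in> adjointable A\<close> the sets are bounded above; for other \<open>T\<close> they need not be, and then
  the value of \<^const>\<open>Sup\<close> carries no meaning.
\<close>

definition op_seminorm :: "('a::chilbert_space \<Rightarrow> 'a) \<Rightarrow> ('a \<Rightarrow> 'a) \<Rightarrow> real" where
  "op_seminorm A T = Sup (insert 0 {seminorm A (T x) | x. seminorm A x = 1})"

definition num_radius :: "('a::chilbert_space \<Rightarrow> 'a) \<Rightarrow> ('a \<Rightarrow> 'a) \<Rightarrow> real" where
  "num_radius A T = Sup (insert 0 {cmod (semi_inner A (T x) x) | x. seminorm A x = 1})"

end

theory Submission
  imports Defs
begin

text \<open>
  The inequality holds pointwise.  Fix \<open>x\<close> with \<open>\<parallel>x\<parallel>\<^sub>A = 1\<close> and put \<open>a = \<parallel>Tx\<parallel>\<^sub>A\<close>, \<open>b = \<parallel>Sx\<parallel>\<^sub>A\<close>.  Then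
  \<open>\<parallel>Tx + Sx\<parallel>\<^sub>A\<^sup>2 = a\<^sup>2 + b\<^sup>2 + 2 Re \<langle>Tx, Sx\<rangle>\<^sub>A\<close>, and the cross term is at most
  \<open>2 |\<langle>S\<^sup>\<sharp>Tx, x\<rangle>\<^sub>A| \<le> 2 w\<^sub>A(S\<^sup>\<sharp>T)\<close>.  The rest is split as
  \<open>a\<^sup>2 + b\<^sup>2 = max (a\<^sup>2) (b\<^sup>2) + min (a\<^sup>2) (b\<^sup>2)\<close>.  The maximum is
  \<open>(a\<^sup>2 + b\<^sup>2 + |a\<^sup>2 - b\<^sup>2|) / 2\<close>, and since \<open>a\<^sup>2 \<plusminus> b\<^sup>2 = \<langle>(T\<^sup>\<sharp>T \<plusminus> S\<^sup>\<sharp>S)x, x\<rangle>\<^sub>A\<close>, the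
  Cauchy-Schwarz inequality bounds it by half the sum of the two operator seminorms.  The minimum
  is at most \<open>a b \<le> \<parallel>T\<parallel>\<^sub>A \<parallel>S\<parallel>\<^sub>A\<close>.

  What has to be supplied is the meaning of the objects involved.  The adjoint exists by
  Riesz representation, and \<open>A T\<^sup>\<sharp> = T\<^sup>* A\<close> follows by projecting onto the kernel of \<open>A\<close>; both
  rest on \<open>closed_subspace_projection\<close>.

  A supremum bounds its members only if the set is bounded above, so every operator
  that occurs must be bounded for the seminorm.  For \<open>T\<close> in \<open>adjointable A\<close> this comes in two steps.  First,
  \<open>A T y\<close> is weakly controlled by \<open>A y\<close>, because \<open>\<langle>ATy, x\<rangle> = \<langle>Ay, T\<^sup>\<sharp>x\<rangle>\<close>, and the uniform
  boundedness principle turns this into \<open>\<parallel>ATy\<parallel> \<le> c \<parallel>Ay\<parallel>\<close>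
  (\<open>adjointable_bounded_range_norm\<close>).  Secondly, \<open>M = T\<^sup>\<sharp>T\<close> is
  symmetric for the semi-inner product and satisfies \<open>\<parallel>AMy\<parallel> \<le> C \<parallel>Ay\<parallel>\<close>; iterating the
  Cauchy-Schwarz inequality along \<open>M\<close>, \<open>M\<^sup>2\<close>, \<open>M\<^sup>4\<close>, and so on gives \<open>\<parallel>My\<parallel>\<^sub>A \<le> C \<parallel>y\<parallel>\<^sub>A\<close>
  (\<open>reid_inequality\<close>), whence \<open>\<parallel>Ty\<parallel>\<^sub>A\<^sup>2 = \<langle>My, y\<rangle>\<^sub>A \<le> C \<parallel>y\<parallel>\<^sub>A\<^sup>2\<close>.
\<close>

section \<open>Orthogonal projection, Riesz representation and uniform boundedness\<close>

text \<open>
  The projection is the point of \<open>M\<close> nearest to \<open>u\<close>.  A minimising sequence converges because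
  of the parallelogram law and completeness, and minimality of the limit forces orthogonality.
\<close>

lemma closed_subspace_projection:
  fixes M :: "'a::{real_inner,banach} set"
  assumes sub: "subspace M" and cl: "closed M"
  obtains p where "p \<in> M" and "\<And>m. m \<in> M \<Longrightarrow> (u - p) \<bullet> m = 0"
proof -
  define D where "D = (\<lambda>m. (norm (u - m))\<^sup>2) ` M"
  define d where "d = Inf D"
  have ne: "D \<noteq> {}" using subspace_0[OF sub] by (auto simp: D_def)
  have bb: "bdd_below D" by (rule bdd_belowI[of _ 0]) (auto simp: D_def)
  have dle: "d \<le> (norm (u - m))\<^sup>2" if "m \<in> M" for m
    unfolding d_def by (rule cInf_lower[OF _ bb]) (use that in \<open>auto simp: D_def\<close>)
  have "\<exists>m\<in>M. (norm (u - m))\<^sup>2 < d + 1 / Suc n" for n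
  proof -
    have "Inf D < d + 1 / Suc n" by (simp add: d_def)
    then show ?thesis using cInf_lessD[OF ne] by (fastforce simp: D_def)
  qed
  then obtain m where mM: "\<And>n. m n \<in> M" and md: "\<And>n. (norm (u - m n))\<^sup>2 < d + 1 / Suc n"
    by metis
  \<comment> \<open>The midpoint of two points of \<open>M\<close> lies in \<open>M\<close>, so by the parallelogram law two near-minimisers
    are close to each other.\<close>
  have close: "(norm (m i - m j))\<^sup>2 \<le> 2 / Suc i + 2 / Suc j" for i j
  proof -
    have "(1/2) *\<^sub>R (m i + m j) \<in> M"
      using sub mM by (simp add: subspace_scale subspace_add)
    from dle[OF this]
    have "4 * d \<le> 4 * (norm (u - (1/2) *\<^sub>R (m i + m j)))\<^sup>2" by simp
    also have "\<dots> = 2 * (norm (u - m i))\<^sup>2 + 2 * (norm (u - m j))\<^sup>2 - (norm (m i - m j))\<^sup>2"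
      by (simp add: power2_norm_eq_inner algebra_simps inner_commute)
    finally show ?thesis using md[of i] md[of j] by simp
  qed
  have "Cauchy m"
  proof (rule metric_CauchyI)
    fix e :: real assume e: "0 < e"
    obtain N where N: "1 / real (Suc N) < e\<^sup>2 / 4"
      using reals_Archimedean[of "e\<^sup>2 / 4"] e by (auto simp: inverse_eq_divide)
    have "dist (m i) (m j) < e" if "i \<ge> N" "j \<ge> N" for i j
    proof -
      have "1 / real (Suc i) \<le> 1 / real (Suc N)" "1 / real (Suc j) \<le> 1 / real (Suc N)"
        using that by (auto simp: frac_le)
      with close[of i j] N have "(norm (m i - m j))\<^sup>2 < e\<^sup>2" by simp
      then show ?thesis using e by (simp add: dist_norm power2_less_imp_less)
    qed
    then show "\<exists>N. \<forall>i\<ge>N. \<forall>j\<ge>N. dist (m i) (m j) < e" by blast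
  qed
  then obtain p where lim: "m \<longlonglongrightarrow> p" using Cauchy_convergent convergent_def by blast
  have pM: "p \<in> M" using closed_sequentially[OF cl _ lim] mM by blast
  have "(norm (u - p))\<^sup>2 \<le> d"
  proof (rule LIMSEQ_le)
    show "(\<lambda>n. (norm (u - m n))\<^sup>2) \<longlonglongrightarrow> (norm (u - p))\<^sup>2" by (intro tendsto_intros lim)
    have "(\<lambda>n. d + 1 / real (Suc n)) \<longlonglongrightarrow> d + 0"
      by (intro tendsto_intros LIMSEQ_Suc[OF lim_1_over_n])
    then show "(\<lambda>n. d + 1 / real (Suc n)) \<longlonglongrightarrow> d" by simp
    show "\<exists>N. \<forall>n\<ge>N. (norm (u - m n))\<^sup>2 \<le> d + 1 / real (Suc n)"
      using md less_imp_le by blast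
  qed
  then have min: "(norm (u - p))\<^sup>2 \<le> (norm (u - k))\<^sup>2" if "k \<in> M" for k
    using dle[OF that] by (rule order_trans)
  have "(u - p) \<bullet> k = 0" if k: "k \<in> M" for k
  proof (cases "k = 0")
    case False
    \<comment> \<open>\<open>t\<close> minimises the quadratic \<open>t \<mapsto> norm (u - (p + t *\<^sub>R k))\<close> squared.\<close>
    define t where "t = ((u - p) \<bullet> k) / (k \<bullet> k)"
    have kk: "k \<bullet> k > 0" using False by simp
    have "p + t *\<^sub>R k \<in> M" using sub pM k by (simp add: subspace_scale subspace_add)
    from min[OF this] have "0 \<le> t * t * (k \<bullet> k) - 2 * t * ((u - p) \<bullet> k)"
      by (simp add: power2_norm_eq_inner algebra_simps inner_commute)
    also have "\<dots> = - (((u - p) \<bullet> k)\<^sup>2 / (k \<bullet> k))"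
      using kk by (simp add: t_def power2_eq_square divide_simps)
    finally have "((u - p) \<bullet> k)\<^sup>2 / (k \<bullet> k) \<le> 0" by simp
    then show ?thesis using kk by (simp add: divide_le_0_iff)
  qed simp
  with pM show thesis by (rule that)
qed

text \<open>
  If \<open>f\<close> is not zero, its kernel has codimension one, so the orthogonal complement of the
  kernel is a line; a suitable multiple of any nonzero vector \<open>e\<close> on it represents \<open>f\<close>.
\<close>

lemma riesz_representation:
  fixes f :: "'a::{real_inner,banach} \<Rightarrow> real"
  assumes f: "bounded_linear f"
  obtains v where "\<And>x. f x = x \<bullet> v"
proof (cases "\<forall>x. f x = 0")
  case True
  then show thesis using that[of 0] by simp
next
  case False
  then obtain u where u: "f u \<noteq> 0" by blast
  interpret bounded_linear f by (rule f)
  have "subspace {x. f x = 0}" by (auto simp: subspace_def add scaleR zero)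
  moreover have "closed {x. f x = 0}"
    using f by (intro closed_Collect_eq continuous_intros) (auto intro: linear_continuous_on)
  ultimately obtain p where p: "f p = 0" and orth: "\<And>m. f m = 0 \<Longrightarrow> (u - p) \<bullet> m = 0"
    using closed_subspace_projection[of "{x. f x = 0}" u] by auto
  define e where "e = u - p"
  have fe: "f e \<noteq> 0" using u p by (simp add: e_def diff)
  then have ee: "e \<bullet> e \<noteq> 0" by (auto simp: zero)
  have "f x = x \<bullet> ((f e / (e \<bullet> e)) *\<^sub>R e)" for x
  proof -
    have "f (x - (f x / f e) *\<^sub>R e) = 0" using fe by (simp add: diff scaleR)
    from orth[OF this] have "e \<bullet> x = (f x / f e) * (e \<bullet> e)"
      by (simp add: e_def[symmetric] inner_diff_right)
    then show ?thesis using fe ee by (simp add: inner_commute field_simps)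
  qed
  then show thesis by (rule that)
qed

text \<open>
  The Banach-Steinhaus theorem for the functionals \<open>x \<mapsto> v \<bullet> x\<close>.  The closed sets \<open>E n\<close> on which
  all of them are bounded by \<open>n\<close> exhaust the space, so by Baire's theorem one of them contains a
  ball of some radius \<open>r\<close>; comparing the centre with the boundary point in direction \<open>v\<close> bounds \<open>norm v\<close>.
\<close>

lemma uniform_boundedness:
  fixes F :: "'a::{real_inner,banach} set"
  assumes pointwise: "\<And>x. \<exists>c. \<forall>v\<in>F. \<bar>v \<bullet> x\<bar> \<le> c"
  obtains C where "\<And>v. v \<in> F \<Longrightarrow> norm v \<le> C"
proof -
  define E where "E n = {x. \<forall>v\<in>F. \<bar>v \<bullet> x\<bar> \<le> real n}" for n :: nat
  have clE: "closed (E n)" for n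
  proof -
    have "E n = (\<Inter>v\<in>F. {x. \<bar>v \<bullet> x\<bar> \<le> real n})" by (auto simp: E_def)
    moreover have "closed {x. \<bar>v \<bullet> x\<bar> \<le> real n}" for v
      by (intro closed_Collect_le continuous_intros)
    ultimately show ?thesis by auto
  qed
  have "\<exists>n. x \<in> E n" for x
  proof -
    obtain c where c: "\<forall>v\<in>F. \<bar>v \<bullet> x\<bar> \<le> c" using pointwise by blast
    obtain n :: nat where "c \<le> real n" using real_arch_simple by blast
    with c have "x \<in> E n" unfolding E_def by (blast intro: order_trans)
    then show ?thesis by blast
  qed
  then have cover: "\<Union>(range E) = UNIV" by blast
  have complete: "Met_TC.mcomplete TYPE('a)"
    by (auto simp: Met_TC.mcomplete_def intro: Cauchy_convergent[unfolded convergent_def])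
  have "\<exists>n. interior (E n) \<noteq> {}"
  proof (rule ccontr)
    assume "\<not> ?thesis"
    then have "Met_TC.mtopology interior_of \<Union>(range E) = {}"
      by (intro Met_TC.metric_Baire_category_alt complete) (auto simp: clE)
    then show False by (simp add: cover)
  qed
  then obtain n x r where r: "r > 0" and ball: "cball x r \<subseteq> E n"
    by (metis ex_in_conv mem_interior_cball)
  have "norm v \<le> 2 * real n / r" if v: "v \<in> F" for v
  proof (cases "v = 0")
    case False
    define y where "y = x + (r / norm v) *\<^sub>R v"
    have "x \<in> E n" "y \<in> E n" using ball r False by (auto simp: y_def dist_norm)
    then have "\<bar>v \<bullet> x\<bar> \<le> real n" "\<bar>v \<bullet> y\<bar> \<le> real n" using v by (auto simp: E_def)
    moreover have "v \<bullet> y = v \<bullet> x + r * norm v"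
      using False by (simp add: y_def inner_add_right power2_norm_eq_inner[symmetric] power2_eq_square)
    ultimately have "r * norm v \<le> 2 * real n" by linarith
    then show ?thesis using r by (simp add: field_simps)
  qed (use r in simp)
  then show thesis by (rule that)
qed

section \<open>Complex Hilbert spaces and adjoints\<close>

text \<open>
  The imaginary part of the complex inner product is a real inner product with a rotated argument.
  An identity between real inner products that holds for all vectors and is compatible with
  complex scalars therefore lifts to the complex inner product, which lets most of the
  development work with the real inner product alone.
\<close>

lemma Im_cinner: "Im (cinner x y) = ((- \<i>) *\<^sub>C x) \<bullet> (y::'a::chilbert_space)"
  by (simp add: Re_cinner[symmetric] cinner_scaleC_left)

lemma cinner_eqI:
  fixes f :: "'a::chilbert_space \<Rightarrow> 'a"
  assumes hom: "\<And>c x. f (c *\<^sub>C x) = c *\<^sub>C f x"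
    and re: "\<And>x. f x \<bullet> y = x \<bullet> v"
  shows "cinner (f x) y = cinner x v"
proof (rule complex_eqI)
  show "Re (cinner (f x) y) = Re (cinner x v)" by (simp add: Re_cinner re)
  show "Im (cinner (f x) y) = Im (cinner x v)" by (simp only: Im_cinner hom[symmetric] re)
qed

lemma cinner_scaleC_right: "cinner x (c *\<^sub>C y) = cnj c * cinner x y"
  by (metis cinner_commute cinner_scaleC_left complex_cnj_mult)

lemma cinner_add_right: "cinner x (y + z) = cinner x y + cinner x z"
  by (metis cinner_add_left cinner_commute complex_cnj_add)

lemma cinner_zero_left: "cinner 0 y = 0"
  using cinner_add_left[of 0 0 y] by simp

lemma scaleC_zero_right: "c *\<^sub>C 0 = (0::'a::chilbert_space)"
  using scaleC_add_right[of c 0 0] by simp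

lemma inner_ext: "(\<And>x. x \<bullet> v = x \<bullet> w) \<Longrightarrow> v = (w::'a::real_inner)"
  by (metis inner_commute vector_eq_rdot)

lemma bounded_clinearD:
  assumes "bounded_clinear T"
  shows "bounded_linear T" "T (x + y) = T x + T y" "T (x - y) = T x - T y" "T (r *\<^sub>R x) = r *\<^sub>R T x"
    "T 0 = 0" "T (c *\<^sub>C x) = c *\<^sub>C T x"
  using assms unfolding bounded_clinear_def
  by (auto simp: linear_simps)

text \<open>
  Represent each functional \<open>x \<mapsto> T x \<bullet> y\<close> by a vector \<open>S y\<close>.  Linearity of \<open>S\<close> follows since a
  vector is determined by its inner products, and the bound for \<open>T\<close> passes to \<open>S\<close> by testing
  \<open>S y\<close> against itself.
\<close>

lemma cadjoint_exists:
  fixes T :: "'a::chilbert_space \<Rightarrow> 'a"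
  assumes T: "bounded_clinear T"
  obtains S where "bounded_clinear S" and "\<And>x y. cinner (T x) y = cinner x (S y)"
proof -
  note Tl = bounded_clinearD[OF T]
  have "\<exists>v. \<forall>x. T x \<bullet> y = x \<bullet> v" for y
  proof -
    have "bounded_linear (\<lambda>x. T x \<bullet> y)"
      by (rule bounded_linear_compose[OF bounded_linear_inner_left Tl(1)])
    then show ?thesis using riesz_representation by metis
  qed
  then obtain S where S: "\<And>x y. T x \<bullet> y = x \<bullet> S y" by metis
  have cS: "cinner (T x) y = cinner x (S y)" for x y
    by (rule cinner_eqI) (auto simp: Tl S)
  obtain K where K: "\<And>x. norm (T x) \<le> norm x * K" using bounded_linear.bounded[OF Tl(1)] by blast
  have bl: "bounded_linear S"
  proof (rule bounded_linear_intro)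
    show "S (x + y) = S x + S y" for x y
      by (rule inner_ext) (simp add: S[symmetric] inner_add_right)
    show "S (r *\<^sub>R x) = r *\<^sub>R S x" for r x
      by (rule inner_ext) (simp add: S[symmetric])
    show "norm (S y) \<le> norm y * K" for y
    proof (cases "S y = 0")
      case True
      have "0 \<le> norm y * K" using K[of y] norm_ge_zero[of "T y"] by linarith
      with True show ?thesis by simp
    next
      case False
      have "norm (S y) * norm (S y) = T (S y) \<bullet> y"
        by (simp add: S power2_norm_eq_inner[symmetric] power2_eq_square)
      also have "\<dots> \<le> norm (T (S y)) * norm y" by (rule norm_cauchy_schwarz)
      also have "\<dots> \<le> norm (S y) * K * norm y" using K by (simp add: mult_right_mono)
      finally show ?thesis using False by (simp add: mult.assoc mult.commute[of K])
    qed
  qed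
  have "S (c *\<^sub>C y) = c *\<^sub>C S y" for c y
  proof (rule inner_ext)
    fix x
    have "cinner x (S (c *\<^sub>C y)) = cinner x (c *\<^sub>C S y)"
      by (simp add: cS[symmetric] cinner_scaleC_right)
    then show "x \<bullet> S (c *\<^sub>C y) = x \<bullet> c *\<^sub>C S y" by (simp flip: Re_cinner)
  qed
  with bl have "bounded_clinear S" by (simp add: bounded_clinear_def)
  then show thesis using cS by (rule that)
qed

lemma
  fixes T :: "'a::chilbert_space \<Rightarrow> 'a"
  assumes T: "bounded_clinear T"
  shows bounded_clinear_cadjoint: "bounded_clinear (cadjoint T)"
    and cinner_cadjoint: "cinner (T x) y = cinner x (cadjoint T y)"
    and inner_cadjoint: "T x \<bullet> y = x \<bullet> cadjoint T y"
proof -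
  let ?P = "\<lambda>S. bounded_clinear S \<and> (\<forall>x y. cinner (T x) y = cinner x (S y))"
  obtain S where S: "?P S" using cadjoint_exists[OF T] by metis
  have "?P (cadjoint T)" unfolding cadjoint_def
  proof (rule theI[of ?P, OF S])
    fix R assume R: "?P R"
    show "R = S"
    proof
      fix y
      show "R y = S y" by (rule inner_ext) (metis R S Re_cinner)
    qed
  qed
  then show "bounded_clinear (cadjoint T)" and *: "cinner (T x) y = cinner x (cadjoint T y)" by auto
  then show "T x \<bullet> y = x \<bullet> cadjoint T y" by (metis Re_cinner)
qed

section \<open>The semi-inner product of a positive operator\<close>

lemma positive_op_inner_nonneg: "positive_op A \<Longrightarrow> 0 \<le> A x \<bullet> x"
  by (metis Re_cinner positive_op_def complex_nonneg_Reals_iff)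

text \<open>
  Polarisation: \<open>\<langle>Az, z\<rangle>\<close> is real for every \<open>z\<close>, in particular for \<open>z = x + \<i> y\<close>, whose mixed
  terms have imaginary part \<open>Ay \<bullet> x - Ax \<bullet> y\<close>.
\<close>

lemma positive_op_selfadjoint:
  assumes A: "positive_op A"
  shows "A x \<bullet> y = x \<bullet> A y"
proof -
  have lin: "bounded_clinear A" using A by (simp add: positive_op_def)
  note Al = bounded_clinearD[OF lin]
  have im0: "Im (cinner (A z) z) = 0" for z
    using A by (metis positive_op_def complex_nonneg_Reals_iff)
  have "0 = Im (cinner (A (x + \<i> *\<^sub>C y)) (x + \<i> *\<^sub>C y))" by (simp only: im0)
  also have "\<dots> = Im (cinner (A x) (\<i> *\<^sub>C y)) + Im (cinner (\<i> *\<^sub>C A y) x)"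
    using im0[of x] im0[of "\<i> *\<^sub>C y"]
    by (simp add: Al cinner_add_left cinner_add_right)
  also have "\<dots> = - (A x \<bullet> y) + A y \<bullet> x"
    by (simp add: cinner_scaleC_right cinner_scaleC_left Re_cinner)
  finally show ?thesis by (simp add: inner_commute)
qed

lemma seminorm_eq_sqrt_inner: "seminorm A x = sqrt (A x \<bullet> x)"
  by (simp add: seminorm_def semi_inner_def Re_cinner)

lemma seminorm_nonneg: "positive_op A \<Longrightarrow> 0 \<le> seminorm A x"
  by (simp add: seminorm_eq_sqrt_inner positive_op_inner_nonneg)

lemma seminorm_power2: "positive_op A \<Longrightarrow> (seminorm A x)\<^sup>2 = A x \<bullet> x"
  by (simp add: seminorm_eq_sqrt_inner positive_op_inner_nonneg)

lemma seminorm_cauchy_schwarz: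
  assumes A: "positive_op A"
  shows "\<bar>A x \<bullet> y\<bar> \<le> seminorm A x * seminorm A y"
proof -
  have lin: "bounded_clinear A" using A by (simp add: positive_op_def)
  note Al = bounded_clinearD[OF lin]
  define a b c where "a = A x \<bullet> x" and "b = A x \<bullet> y" and "c = A y \<bullet> y"
  have quad: "0 \<le> s * s * a + 2 * s * t * b + t * t * c" for s t
  proof -
    have "A (s *\<^sub>R x + t *\<^sub>R y) \<bullet> (s *\<^sub>R x + t *\<^sub>R y) = s * s * a + 2 * s * t * b + t * t * c"
      using positive_op_selfadjoint[OF A, of y x]
      by (simp add: Al inner_add_left inner_add_right a_def b_def c_def inner_commute algebra_simps)
    then show ?thesis using positive_op_inner_nonneg[OF A, of "s *\<^sub>R x + t *\<^sub>R y"] by simp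
  qed
  have a0: "0 \<le> a" and c0: "0 \<le> c" using A by (auto simp: a_def c_def positive_op_inner_nonneg)
  have "b\<^sup>2 \<le> a * c"
  proof (cases "c = 0")
    case True
    \<comment> \<open>With \<open>c = 0\<close> the quadratic form is affine in \<open>t\<close>, so its slope \<open>b\<close> vanishes.\<close>
    have "b = 0"
    proof (rule ccontr)
      assume b: "b \<noteq> 0"
      from quad[of 1 "- (a + 1) / (2 * b)"] b True show False by (simp add: field_simps)
    qed
    then show ?thesis using True by simp
  next
    case False
    then have cp: "0 < c" using c0 by simp
    \<comment> \<open>\<open>(c, - b)\<close> is proportional to \<open>(1, - b / c)\<close>, where the form is smallest for \<open>s = 1\<close>.\<close>
    from quad[of c "- b"] have "0 \<le> c * (a * c - b\<^sup>2)"
      by (simp add: algebra_simps power2_eq_square)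
    then show ?thesis using cp by (simp add: zero_le_mult_iff)
  qed
  then have "\<bar>b\<bar> \<le> sqrt (a * c)" by (rule real_le_rsqrt[of "\<bar>b\<bar>", simplified])
  then show ?thesis by (simp add: seminorm_eq_sqrt_inner a_def b_def c_def real_sqrt_mult)
qed

lemma seminorm_scaleC:
  assumes A: "positive_op A"
  shows "seminorm A (c *\<^sub>C x) = cmod c * seminorm A x"
proof -
  have Al: "A (c *\<^sub>C x) = c *\<^sub>C A x" using A by (simp add: positive_op_def bounded_clinearD)
  have "cinner (c *\<^sub>C A x) (c *\<^sub>C x) = complex_of_real ((cmod c)\<^sup>2) * cinner (A x) x"
    by (simp add: cinner_scaleC_left cinner_scaleC_right complex_norm_square del: of_real_power)
  then show ?thesis
    by (simp add: seminorm_def semi_inner_def Al real_sqrt_mult)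
qed

text \<open>
  Rotating \<open>x\<close> by a phase makes \<open>\<langle>x, y\<rangle>\<^sub>A\<close> real and nonnegative, which reduces the complex
  inequality to the real one.
\<close>

lemma semi_inner_cauchy_schwarz:
  assumes A: "positive_op A"
  shows "cmod (semi_inner A x y) \<le> seminorm A x * seminorm A y"
proof -
  have Al: "A (c *\<^sub>C x) = c *\<^sub>C A x" for c using A by (simp add: positive_op_def bounded_clinearD)
  define z where "z = semi_inner A x y"
  define c where "c = cnj (sgn z)"
  have "complex_of_real (cmod z) = c * z"
    by (cases "z = 0") (auto simp: c_def sgn_eq mult.commute[of "cnj z"] complex_norm_square[symmetric]
        power2_eq_square)
  then have "cmod z = Re (c * z)" by (metis Re_complex_of_real)
  also have "\<dots> = A (c *\<^sub>C x) \<bullet> y"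
    by (simp only: z_def semi_inner_def Al Re_cinner[symmetric] cinner_scaleC_left)
  also have "\<dots> \<le> seminorm A (c *\<^sub>C x) * seminorm A y"
    using seminorm_cauchy_schwarz[OF A] abs_le_D1 by blast
  also have "\<dots> \<le> 1 * seminorm A x * seminorm A y"
    by (intro mult_right_mono) (auto simp: A seminorm_scaleC seminorm_nonneg c_def norm_sgn)
  finally show ?thesis by (simp add: z_def)
qed

lemma seminorm_add_power2:
  assumes A: "positive_op A"
  shows "(seminorm A (x + y))\<^sup>2 = (seminorm A x)\<^sup>2 + (seminorm A y)\<^sup>2 + 2 * (A x \<bullet> y)"
proof -
  have Al: "A (x + y) = A x + A y" using A by (simp add: positive_op_def bounded_clinearD)
  show ?thesis
    using positive_op_selfadjoint[OF A, of y x]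
    by (simp add: A seminorm_power2 Al inner_add_left inner_add_right inner_commute)
qed

lemma seminorm_triangle:
  assumes A: "positive_op A"
  shows "seminorm A (x + y) \<le> seminorm A x + seminorm A y"
proof (rule power2_le_imp_le)
  show "(seminorm A (x + y))\<^sup>2 \<le> (seminorm A x + seminorm A y)\<^sup>2"
    using seminorm_cauchy_schwarz[OF A, of x y]
    by (simp add: seminorm_add_power2[OF A] power2_sum)
  show "0 \<le> seminorm A x + seminorm A y" using A by (simp add: seminorm_nonneg)
qed

section \<open>The sharp adjoint and boundedness in the seminorm\<close>

text \<open>
  For \<open>y = A u\<close>, subtracting from \<open>u\<close> its projection \<open>p\<close> onto the kernel of \<open>A\<close> leaves a preimage
  of \<open>y\<close> orthogonal to the kernel.  It is the only candidate: the component \<open>z\<close> of a second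
  decomposition lies in the range of \<open>A\<close> and is orthogonal to it, so it vanishes, and then the difference of the
  two preimages lies in the kernel and is orthogonal to it.
\<close>

lemma mp_inverse_range:
  assumes A: "positive_op A" and y: "y \<in> range A"
  shows "A (mp_inverse A y) = y"
proof -
  have lin: "bounded_clinear A" using A by (simp add: positive_op_def)
  note Al = bounded_clinearD[OF lin]
  let ?N = "{u. A u = 0}"
  let ?P = "\<lambda>x. x \<in> orth_compl ?N \<and> (\<exists>z \<in> orth_compl (range A). y = A x + z)"
  obtain u where u: "y = A u" using y by blast
  have "subspace ?N" by (auto simp: subspace_def Al)
  moreover have "closed ?N"
    by (intro closed_Collect_eq continuous_intros) (rule linear_continuous_on[OF Al(1)])
  ultimately obtain p where p: "A p = 0" and orth: "\<And>m. A m = 0 \<Longrightarrow> (u - p) \<bullet> m = 0"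
    using closed_subspace_projection[of ?N u] by auto
  have "cinner (u - p) m = 0" if m: "A m = 0" for m
  proof -
    have "cinner m (u - p) = 0"
    proof (rule complex_eqI)
      show "Re (cinner m (u - p)) = Re 0" using orth[OF m] by (simp add: Re_cinner inner_commute)
      have "A ((- \<i>) *\<^sub>C m) = (- \<i>) *\<^sub>C (0::'a)" using m by (simp only: Al)
      also have "\<dots> = 0" by (rule scaleC_zero_right)
      finally have "A ((- \<i>) *\<^sub>C m) = 0" .
      from orth[OF this] show "Im (cinner m (u - p)) = Im 0" by (simp add: Im_cinner inner_commute)
    qed
    then show ?thesis by (metis cinner_commute complex_cnj_zero)
  qed
  then have "?P (u - p)" using p u
    by (auto simp: orth_compl_def Al cinner_zero_left intro!: bexI[of _ 0])
  moreover have uniq: "A x = y \<and> x = u - p" if Px: "?P x" for x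
  proof -
    obtain z where z: "z \<in> orth_compl (range A)" "y = A x + z" using Px by blast
    have "z = A (u - x)" using z u by (simp add: Al)
    then have "cinner z z = 0" using z(1) by (auto simp: orth_compl_def)
    then have z0: "z = 0" by (metis Re_cinner inner_eq_zero_iff zero_complex.sel(1))
    define k where "k = x - (u - p)"
    have k: "A k = 0" using z z0 u p by (simp add: k_def Al)
    have "cinner x k = 0" using Px k by (auto simp: orth_compl_def)
    then have "x \<bullet> k = 0" by (metis Re_cinner zero_complex.sel(1))
    with orth[OF k] have "k \<bullet> k = 0" by (simp add: k_def inner_diff_left)
    then show ?thesis using z z0 by (simp add: k_def)
  qed
  ultimately have "mp_inverse A y = u - p" unfolding mp_inverse_def
    by (intro the_equality) blast+
  then show ?thesis using u p by (simp add: Al)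
qed

lemma positive_op_sharp:
  assumes A: "positive_op A" and T: "T \<in> adjointable A"
  shows "A (sharp A T x) = cadjoint T (A x)"
  using T mp_inverse_range[OF A, of "cadjoint T (A x)"] by (auto simp: sharp_def adjointable_def)

text \<open>
  The vectors \<open>A (T y)\<close>, divided by \<open>norm (A y)\<close>, are bounded against each fixed \<open>x\<close> by
  \<open>norm (sharp A T x)\<close>, because \<open>A (T y) \<bullet> x = A y \<bullet> sharp A T x\<close>.  Uniform boundedness makes the
  bound independent of \<open>x\<close>.
\<close>

lemma adjointable_bounded_range_norm:
  assumes A: "positive_op A" and T: "T \<in> adjointable A"
  obtains c where "c > 0" and "\<And>y. norm (A (T y)) \<le> c * norm (A y)"
proof -
  have lin: "bounded_clinear T" using T by (simp add: adjointable_def)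
  note sym = positive_op_selfadjoint[OF A]
  have weak: "\<bar>A (T y) \<bullet> x\<bar> \<le> norm (A y) * norm (sharp A T x)" for x y
  proof -
    have "A (T y) \<bullet> x = A y \<bullet> sharp A T x"
      by (simp add: sym inner_cadjoint[OF lin] positive_op_sharp[OF A T])
    then show ?thesis by (simp add: Cauchy_Schwarz_ineq2)
  qed
  \<comment> \<open>Where \<open>A y = 0\<close> the family contributes the zero vector; those \<open>y\<close> are treated separately below.\<close>
  let ?F = "range (\<lambda>y. A (T y) /\<^sub>R norm (A y))"
  have "\<exists>c. \<forall>v\<in>?F. \<bar>v \<bullet> x\<bar> \<le> c" for x
  proof (intro exI[of _ "norm (sharp A T x)"] ballI)
    fix v assume "v \<in> ?F"
    then obtain y where v: "v = A (T y) /\<^sub>R norm (A y)" by blast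
    show "\<bar>v \<bullet> x\<bar> \<le> norm (sharp A T x)"
    proof (cases "A y = 0")
      case False
      then show ?thesis using weak[of y x] by (simp add: v abs_mult field_simps)
    qed (simp add: v)
  qed
  then obtain C where C: "\<And>v. v \<in> ?F \<Longrightarrow> norm v \<le> C" using uniform_boundedness[of ?F] by blast
  have "norm (A (T y)) \<le> (\<bar>C\<bar> + 1) * norm (A y)" for y
  proof (cases "A y = 0")
    case True
    \<comment> \<open>The weak estimate tested against \<open>A (T y)\<close> itself.\<close>
    then have "A (T y) \<bullet> A (T y) = 0" using weak[of y "A (T y)"]
      by (metis True abs_le_zero_iff mult_zero_left norm_zero)
    then have "A (T y) = 0" by (simp only: inner_eq_zero_iff)
    then show ?thesis using True by simp
  next
    case False
    have "norm (A (T y)) / norm (A y) \<le> C" using C[of "A (T y) /\<^sub>R norm (A y)"]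
      by (simp add: field_simps)
    then have "norm (A (T y)) / norm (A y) \<le> \<bar>C\<bar> + 1" by linarith
    then show ?thesis using False by (simp add: field_simps)
  qed
  then show thesis by (intro that[of "\<bar>C\<bar> + 1"]) auto
qed

text \<open>
  An operator symmetric for the semi-inner product inherits a seminorm bound from a bound that
  only controls \<open>A M\<close> by \<open>A\<close> in the Hilbert norm.  By symmetry
  \<open>\<parallel>M\<^sup>ny\<parallel>\<^sub>A\<^sup>2 = \<langle>AM\<^sup>2\<^sup>ny, y\<rangle>\<close>.  On the one hand this is at most \<open>\<parallel>M\<^sup>2\<^sup>ny\<parallel>\<^sub>A \<parallel>y\<parallel>\<^sub>A\<close>, so
  repeated doubling of \<open>n\<close> gives \<open>\<parallel>M\<^sup>ky\<parallel>\<^sub>A \<ge> r\<^sup>k \<parallel>y\<parallel>\<^sub>A\<close> for every power \<open>k\<close> of two, where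
  \<open>r = \<parallel>My\<parallel>\<^sub>A / \<parallel>y\<parallel>\<^sub>A\<close>; on the other hand it is at most a constant times \<open>C\<^sup>2\<^sup>n\<close>.  Hence \<open>r\<close>
  cannot exceed \<open>C\<close>.
\<close>

lemma reid_inequality:
  assumes A: "positive_op A" and C: "C > 0"
    and sym: "\<And>x y. A (M x) \<bullet> y = A x \<bullet> M y"
    and bound: "\<And>x. norm (A (M x)) \<le> C * norm (A x)"
  shows "seminorm A (M y) \<le> C * seminorm A y"
proof -
  let ?q = "seminorm A"
  have symn: "A ((M ^^ n) x) \<bullet> z = A x \<bullet> (M ^^ n) z" for n x z
    by (induction n arbitrary: z) (simp_all add: sym flip: funpow_swap1)
  have boundn: "norm (A ((M ^^ n) x)) \<le> C ^ n * norm (A x)" for n x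
  proof (induction n)
    case (Suc n)
    have "norm (A ((M ^^ Suc n) x)) \<le> C * norm (A ((M ^^ n) x))" by (simp add: bound)
    also have "\<dots> \<le> C * (C ^ n * norm (A x))" using Suc C by simp
    finally show ?case by (simp add: mult.assoc)
  qed simp
  have square: "(?q ((M ^^ n) y))\<^sup>2 = A ((M ^^ (2 * n)) y) \<bullet> y" for n
    \<comment> \<open>Move one factor \<open>M ^^ n\<close> to the other side.\<close>
    by (simp add: seminorm_power2[OF A] symn[of n "(M ^^ n) y" y, symmetric] mult_2 funpow_add)
  define K where "K = sqrt (norm (A y) * norm y)"
  have growth: "?q ((M ^^ n) y) \<le> C ^ n * K" for n
  proof (rule power2_le_imp_le)
    have "(?q ((M ^^ n) y))\<^sup>2 \<le> norm (A ((M ^^ (2 * n)) y)) * norm y"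
      unfolding square by (rule norm_cauchy_schwarz)
    also have "\<dots> \<le> C ^ (2 * n) * norm (A y) * norm y" by (intro mult_right_mono boundn) simp
    also have "\<dots> = (C ^ n * K)\<^sup>2"
      by (simp add: K_def power_mult_distrib power_mult[symmetric] mult.commute[of 2])
    finally show "(?q ((M ^^ n) y))\<^sup>2 \<le> (C ^ n * K)\<^sup>2" .
    show "0 \<le> C ^ n * K" using C by (simp add: K_def)
  qed
  have step: "(?q ((M ^^ n) y))\<^sup>2 \<le> ?q ((M ^^ (2 * n)) y) * ?q y" for n
    unfolding square using seminorm_cauchy_schwarz[OF A] abs_le_D1 by blast
  show ?thesis
  proof (cases "?q y = 0")
    case True
    then show ?thesis using step[of 1] by simp
  next
    case False
    then have qp: "?q y > 0" using seminorm_nonneg[OF A, of y] by linarith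
    define r where "r = ?q (M y) / ?q y"
    have r0: "0 \<le> r" using qp by (simp add: r_def A seminorm_nonneg)
    have doubling: "r ^ (2 ^ n) \<le> ?q ((M ^^ (2 ^ n)) y) / ?q y" for n
    proof (induction n)
      case (Suc n)
      have "r ^ (2 ^ Suc n) = (r ^ (2 ^ n))\<^sup>2" by (simp add: power_mult[symmetric] mult.commute)
      also have "\<dots> \<le> (?q ((M ^^ (2 ^ n)) y) / ?q y)\<^sup>2" using Suc r0 by (simp add: power_mono)
      also have "\<dots> \<le> ?q ((M ^^ (2 ^ Suc n)) y) / ?q y"
        using step[of "2 ^ n"] qp by (simp add: power_divide power2_eq_square field_simps)
      finally show ?case .
    qed (simp add: r_def)
    have "r \<le> C"
    proof (rule ccontr)
      assume "\<not> r \<le> C"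
      then have "1 < r / C" using C by simp
      then obtain n where n: "K / ?q y < (r / C) ^ n" using real_arch_pow by blast
      have "(r / C) ^ n \<le> (r / C) ^ (2 ^ n)"
        using \<open>1 < r / C\<close> by (intro power_increasing) (auto intro: less_imp_le less_exp)
      also have "\<dots> \<le> K / ?q y"
      proof -
        have "r ^ (2 ^ n) \<le> C ^ (2 ^ n) * K / ?q y"
          using doubling[of n] growth[of "2 ^ n"] qp by (smt (verit) divide_right_mono)
        then show ?thesis using C by (simp add: power_divide field_simps)
      qed
      finally show False using n by simp
    qed
    then show ?thesis using qp by (simp add: r_def field_simps)
  qed
qed

lemma inner_sharp:
  assumes A: "positive_op A" and S: "S \<in> adjointable A"
  shows "A (sharp A S x) \<bullet> y = A x \<bullet> S y"
proof -
  have "bounded_clinear S" using S by (simp add: adjointable_def)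
  from inner_cadjoint[OF this, of y "A x"] show ?thesis
    by (simp add: positive_op_sharp[OF A S] inner_commute)
qed

lemma semi_inner_sharp:
  assumes A: "positive_op A" and S: "S \<in> adjointable A"
  shows "semi_inner A (sharp A S x) y = semi_inner A x (S y)"
proof -
  have "bounded_clinear S" using S by (simp add: adjointable_def)
  from cinner_cadjoint[OF this, of y "A x"] show ?thesis
    unfolding semi_inner_def positive_op_sharp[OF A S] by (metis cinner_commute)
qed

lemma sharp_comp_seminorm_bounded:
  assumes A: "positive_op A" and T: "T \<in> adjointable A"
  obtains C where "C > 0" and "\<And>y. seminorm A (sharp A T (T y)) \<le> C * seminorm A y"
proof -
  have lin: "bounded_clinear T" using T by (simp add: adjointable_def)
  obtain c where c: "c > 0" "\<And>y. norm (A (T y)) \<le> c * norm (A y)"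
    using adjointable_bounded_range_norm[OF A T] by blast
  obtain K where K: "K > 0" "\<And>x. norm (cadjoint T x) \<le> norm x * K"
    using bounded_linear.pos_bounded[OF bounded_clinearD(1)[OF bounded_clinear_cadjoint[OF lin]]]
    by blast
  have "seminorm A (sharp A T (T y)) \<le> (c * K) * seminorm A y" for y
  proof (rule reid_inequality[OF A])
    show "0 < c * K" using c K by simp
    show "A (sharp A T (T x)) \<bullet> y = A x \<bullet> sharp A T (T y)" for x y
      using inner_sharp[OF A T, of "T x" y] inner_sharp[OF A T, of "T y" x]
        positive_op_selfadjoint[OF A] by (metis inner_commute)
    show "norm (A (sharp A T (T x))) \<le> c * K * norm (A x)" for x
    proof -
      have "norm (A (sharp A T (T x))) \<le> norm (A (T x)) * K"
        by (simp add: positive_op_sharp[OF A T] K)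
      also have "\<dots> \<le> c * norm (A x) * K" using c K by (simp add: mult_right_mono)
      finally show ?thesis by (simp add: ac_simps)
    qed
  qed
  then show thesis using c K by (intro that[of "c * K"]) auto
qed

text \<open>
  Combines the bound for \<open>T\<^sup>\<sharp>T\<close> with the Cauchy-Schwarz inequality: \<open>\<parallel>Ty\<parallel>\<^sub>A\<^sup>2 = \<langle>T\<^sup>\<sharp>Ty, y\<rangle>\<^sub>A \<le> \<parallel>T\<^sup>\<sharp>Ty\<parallel>\<^sub>A \<parallel>y\<parallel>\<^sub>A\<close>.
\<close>

lemma adjointable_seminorm_bounded:
  assumes A: "positive_op A" and T: "T \<in> adjointable A"
  obtains C where "C > 0" and "\<And>y. seminorm A (T y) \<le> C * seminorm A y"
proof -
  obtain C where C: "C > 0" "\<And>y. seminorm A (sharp A T (T y)) \<le> C * seminorm A y"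
    using sharp_comp_seminorm_bounded[OF A T] by blast
  have "seminorm A (T y) \<le> sqrt C * seminorm A y" for y
  proof (rule power2_le_imp_le)
    have "(seminorm A (T y))\<^sup>2 = A (sharp A T (T y)) \<bullet> y"
      by (simp add: seminorm_power2[OF A] inner_sharp[OF A T])
    also have "\<dots> \<le> seminorm A (sharp A T (T y)) * seminorm A y"
      using seminorm_cauchy_schwarz[OF A] abs_le_D1 by blast
    also have "\<dots> \<le> C * seminorm A y * seminorm A y"
      by (intro mult_right_mono C seminorm_nonneg[OF A])
    also have "\<dots> = (sqrt C * seminorm A y)\<^sup>2"
      using C(1) by (simp add: power_mult_distrib) (simp add: power2_eq_square)
    finally show "(seminorm A (T y))\<^sup>2 \<le> (sqrt C * seminorm A y)\<^sup>2" .
    show "0 \<le> sqrt C * seminorm A y" using C by (simp add: seminorm_nonneg[OF A])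
  qed
  then show thesis using C by (intro that[of "sqrt C"]) auto
qed

section \<open>Operator seminorm and numerical radius as suprema\<close>

lemma
  assumes bound: "\<And>x. seminorm A x = 1 \<Longrightarrow> seminorm A (R x) \<le> C"
  shows seminorm_le_op_seminorm: "seminorm A x = 1 \<Longrightarrow> seminorm A (R x) \<le> op_seminorm A R"
    and op_seminorm_nonneg: "0 \<le> op_seminorm A R"
proof -
  have bdd: "bdd_above (insert 0 {seminorm A (R x) |x. seminorm A x = 1})"
    using bound by (auto intro!: bdd_aboveI[of _ C])
  show "seminorm A x = 1 \<Longrightarrow> seminorm A (R x) \<le> op_seminorm A R"
    unfolding op_seminorm_def by (rule cSup_upper[OF _ bdd]) auto
  show "0 \<le> op_seminorm A R"
    unfolding op_seminorm_def by (rule cSup_upper[OF _ bdd]) auto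
qed

lemma
  assumes bound: "\<And>x. seminorm A x = 1 \<Longrightarrow> cmod (semi_inner A (R x) x) \<le> C"
  shows semi_inner_le_num_radius:
      "seminorm A x = 1 \<Longrightarrow> cmod (semi_inner A (R x) x) \<le> num_radius A R"
    and num_radius_nonneg: "0 \<le> num_radius A R"
proof -
  have bdd: "bdd_above (insert 0 {cmod (semi_inner A (R x) x) |x. seminorm A x = 1})"
    using bound by (auto intro!: bdd_aboveI[of _ C])
  show "seminorm A x = 1 \<Longrightarrow> cmod (semi_inner A (R x) x) \<le> num_radius A R"
    unfolding num_radius_def by (rule cSup_upper[OF _ bdd]) auto
  show "0 \<le> num_radius A R"
    unfolding num_radius_def by (rule cSup_upper[OF _ bdd]) auto
qed

lemma op_seminorm_power2_le:
  assumes A: "positive_op A" and B: "0 \<le> B"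
    and le: "\<And>x. seminorm A x = 1 \<Longrightarrow> (seminorm A (R x))\<^sup>2 \<le> B"
  shows "(op_seminorm A R)\<^sup>2 \<le> B"
proof -
  have le': "seminorm A (R x) \<le> sqrt B" if "seminorm A x = 1" for x
    using le[OF that] by (simp add: real_le_rsqrt)
  have "op_seminorm A R \<le> sqrt B"
    unfolding op_seminorm_def by (rule cSup_least) (use le' B in auto)
  then have "(op_seminorm A R)\<^sup>2 \<le> (sqrt B)\<^sup>2"
    by (rule power_mono[OF _ op_seminorm_nonneg[OF le']])
  then show ?thesis using B by simp
qed

section \<open>The inequality\<close>

theorem theorem4p1:
  fixes A T S :: "'h::chilbert_space \<Rightarrow> 'h"
  assumes nontrivial: "\<exists>x::'h. x \<noteq> 0"
    and A: "positive_op A"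
    and T: "T \<in> adjointable A"
    and S: "S \<in> adjointable A"
  shows "(op_seminorm A (\<lambda>x. T x + S x))\<^sup>2 \<le>
    1 / 2 * (op_seminorm A (\<lambda>x. sharp A T (T x) + sharp A S (S x))
           + op_seminorm A (\<lambda>x. sharp A T (T x) - sharp A S (S x)))
    + op_seminorm A T * op_seminorm A S
    + 2 * num_radius A (sharp A S \<circ> T)"
proof -
  let ?q = "seminorm A"
  let ?P = "\<lambda>x. sharp A T (T x) + sharp A S (S x)"
  let ?D = "\<lambda>x. sharp A T (T x) - sharp A S (S x)"
  have lin: "bounded_clinear A" using A by (simp add: positive_op_def)
  note Al = bounded_clinearD[OF lin]
  obtain c1 where c1: "\<And>y. ?q (T y) \<le> c1 * ?q y" using adjointable_seminorm_bounded[OF A T] by blast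
  obtain c2 where c2: "\<And>y. ?q (S y) \<le> c2 * ?q y" using adjointable_seminorm_bounded[OF A S] by blast
  obtain d1 where d1: "\<And>y. ?q (sharp A T (T y)) \<le> d1 * ?q y"
    using sharp_comp_seminorm_bounded[OF A T] by blast
  obtain d2 where d2: "\<And>y. ?q (sharp A S (S y)) \<le> d2 * ?q y"
    using sharp_comp_seminorm_bounded[OF A S] by blast
  have neg: "?q (- y) = ?q y" for y
    using Al(4)[of "-1" y] by (simp add: seminorm_eq_sqrt_inner)
  have bT: "?q (T x) \<le> c1" and bS: "?q (S x) \<le> c2" and bP: "?q (?P x) \<le> d1 + d2"
    and bD: "?q (?D x) \<le> d1 + d2" if "?q x = 1" for x
    using c1[of x] c2[of x] d1[of x] d2[of x] that
      seminorm_triangle[OF A, of "sharp A T (T x)" "sharp A S (S x)"]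
      seminorm_triangle[OF A, of "sharp A T (T x)" "- sharp A S (S x)"]
    by (auto simp: neg)
  have w_eq: "semi_inner A ((sharp A S \<circ> T) x) x = semi_inner A (T x) (S x)" for x
    by (simp add: semi_inner_sharp[OF A S])
  have bW: "cmod (semi_inner A ((sharp A S \<circ> T) x) x) \<le> c1 * c2" if "?q x = 1" for x
  proof -
    have "cmod (semi_inner A (T x) (S x)) \<le> ?q (T x) * ?q (S x)"
      by (rule semi_inner_cauchy_schwarz[OF A])
    also have "\<dots> \<le> c1 * c2"
      using bT[OF that] bS[OF that] seminorm_nonneg[OF A] by (meson mult_mono order_trans)
    finally show ?thesis by (simp only: w_eq)
  qed
  note nn = op_seminorm_nonneg[of A T, OF bT] op_seminorm_nonneg[of A S, OF bS]
    op_seminorm_nonneg[of A ?P, OF bP] op_seminorm_nonneg[of A ?D, OF bD]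
    num_radius_nonneg[of A "sharp A S \<circ> T", OF bW]
  show ?thesis
  proof (rule op_seminorm_power2_le[OF A])
    show "0 \<le> 1 / 2 * (op_seminorm A ?P + op_seminorm A ?D) + op_seminorm A T * op_seminorm A S
      + 2 * num_radius A (sharp A S \<circ> T)"
      using nn by (intro add_nonneg_nonneg mult_nonneg_nonneg) auto
  next
    fix x assume x: "?q x = 1"
    define a b where "a = ?q (T x)" and "b = ?q (S x)"
    have ab: "0 \<le> a" "0 \<le> b" by (auto simp: a_def b_def seminorm_nonneg[OF A])
    have a2: "a\<^sup>2 = A (sharp A T (T x)) \<bullet> x"
      by (simp add: a_def seminorm_power2[OF A] inner_sharp[OF A T])
    have b2: "b\<^sup>2 = A (sharp A S (S x)) \<bullet> x"
      by (simp add: b_def seminorm_power2[OF A] inner_sharp[OF A S])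
    have "a\<^sup>2 + b\<^sup>2 = A (?P x) \<bullet> x" by (simp add: a2 b2 Al inner_add_left)
    also have "\<dots> \<le> ?q (?P x)" using seminorm_cauchy_schwarz[OF A, of "?P x" x] x by simp
    also have "\<dots> \<le> op_seminorm A ?P" by (rule seminorm_le_op_seminorm[of A ?P, OF bP x])
    finally have sum: "a\<^sup>2 + b\<^sup>2 \<le> op_seminorm A ?P" .
    have "\<bar>a\<^sup>2 - b\<^sup>2\<bar> = \<bar>A (?D x) \<bullet> x\<bar>" by (simp add: a2 b2 Al inner_diff_left)
    also have "\<dots> \<le> ?q (?D x)" using seminorm_cauchy_schwarz[OF A, of "?D x" x] x by simp
    also have "\<dots> \<le> op_seminorm A ?D" by (rule seminorm_le_op_seminorm[of A ?D, OF bD x])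
    finally have diff: "\<bar>a\<^sup>2 - b\<^sup>2\<bar> \<le> op_seminorm A ?D" .
    have "min (a\<^sup>2) (b\<^sup>2) \<le> a * b"
      using ab by (cases "a \<le> b") (auto simp: power2_eq_square min_le_iff_disj mult_left_mono mult_right_mono)
    also have "\<dots> \<le> op_seminorm A T * op_seminorm A S"
      unfolding a_def b_def
      using seminorm_le_op_seminorm[of A T, OF bT x] seminorm_le_op_seminorm[of A S, OF bS x]
      by (intro mult_mono nn seminorm_nonneg[OF A])
    finally have min: "min (a\<^sup>2) (b\<^sup>2) \<le> op_seminorm A T * op_seminorm A S" .
    have "A (T x) \<bullet> S x = Re (semi_inner A (T x) (S x))" by (simp add: semi_inner_def Re_cinner)
    also have "\<dots> \<le> cmod (semi_inner A (T x) (S x))" by (rule complex_Re_le_cmod)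
    also have "\<dots> \<le> num_radius A (sharp A S \<circ> T)"
      using semi_inner_le_num_radius[of A "sharp A S \<circ> T", OF bW x] by (simp only: w_eq)
    finally have cross: "A (T x) \<bullet> S x \<le> num_radius A (sharp A S \<circ> T)" .
    have "(?q (T x + S x))\<^sup>2 = a\<^sup>2 + b\<^sup>2 + 2 * (A (T x) \<bullet> S x)"
      by (simp add: seminorm_add_power2[OF A] a_def b_def)
    also have "a\<^sup>2 + b\<^sup>2 = 1 / 2 * (a\<^sup>2 + b\<^sup>2 + \<bar>a\<^sup>2 - b\<^sup>2\<bar>) + min (a\<^sup>2) (b\<^sup>2)" by (auto simp: min_def)
    finally show "(?q (T x + S x))\<^sup>2 \<le> 1 / 2 * (op_seminorm A ?P + op_seminorm A ?D)
      + op_seminorm A T * op_seminorm A S + 2 * num_radius A (sharp A S \<circ> T)"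
      using sum diff min cross by argo
  qed
qed

end
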